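(* Let $G$ be a group with identity $e$, and let $\Gamma$ be the graph obtained from the endomorphism graph of $G$ by deleting the vertex $e$. Then $\Gamma$ is a tree if and only if $G\cong\mathbb{Z}_2$ or $G\cong\mathbb{Z}_3$.
   Context: The endomorphism graph of a group $G$ is the simple undirected graph with vertex set $G$ in which distinct $x,y$ are adjacent if and only if some endomorphism of $G$ maps $x$ to $y$ or maps $y$ to $x$. A tree is a nonempty connected graph without cycles (so a single vertex is a tree). *)

theory Defs
  imports "HOL-Algebra.Elementary_Groups" "Graph_Theory.Digraph_Component"
begin

text \<open>
  A simple undirected graph is represented, as usual in Graph_Theory, by a symmetric loop-free
  relation on the vertices: each edge is a pair of opposite arcs. No finiteness is assumed.
\<close>

definition endomorphism_graph :: "('a, 'b) monoid_scheme \<Rightarrow> 'a pair_pre_digraph" where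
  "endomorphism_graph G =
     \<lparr> pverts = carrier G,
       parcs = {(x, y). x \<in> carrier G \<and> y \<in> carrier G \<and> x \<noteq> y \<and>
                        (\<exists>f \<in> hom G G. f x = y \<or> f y = x)} \<rparr>"

lemma pair_bidirected_digraph_endomorphism_graph:
  "pair_bidirected_digraph (endomorphism_graph G)"
  by unfold_locales (auto simp: endomorphism_graph_def symmetric_def sym_def)

text \<open>
  In a symmetric digraph, the library's \<^const>\<open>pre_digraph.cycle\<close> also holds of a closed walk
  \<open>u, v, u\<close> that runs back and forth along one edge, so \<^const>\<open>tree\<close> would exclude every
  symmetric digraph with an edge. In a simple undirected graph a cycle has at least three edges.
  Nonemptiness is part of \<^const>\<open>Digraph_Component.connected\<close>.
\<close>

definition undirected_tree :: "('a, 'b) pre_digraph \<Rightarrow> bool" where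
  "undirected_tree G \<longleftrightarrow>
     Digraph_Component.connected G \<and> \<not> (\<exists>p. pre_digraph.cycle G p \<and> length p \<ge> 3)"

end

theory Submission
  imports Defs "HOL-Algebra.Multiplicative_Group" "HOL-Computational_Algebra.Primes"
begin

text \<open>
  The only consequence of acyclicity that matters is the absence of triangles among the
  non-identity elements. It already forces the group to be tiny, because endomorphisms create
  triangles very easily.

  If \<open>a\<close> and \<open>b\<close> do not commute, conjugation makes each conjugacy class a clique, so classes
  have at most two elements. Then the product of two elements that do not commute with \<open>a\<close>
  commutes with \<open>a\<close>, and the commutator \<open>z\<close> of \<open>b\<close> and \<open>a\<close> is an involution. Hence sending the
  centralizer of \<open>a\<close> to the identity and everything else to \<open>z\<close> is an endomorphism. It joins \<open>z\<close>
  to both \<open>b\<close> and the other conjugate of \<open>b\<close>, which is a triangle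
  (\<open>endo_triangle_free_imp_commute\<close>). So the group is abelian.

  In an abelian group all power maps are endomorphisms, and \<open>x\<close>, its inverse and its square form a
  triangle unless the order of \<open>x\<close> divides 2 or 3. Orders 2 and 3 cannot both occur, since a
  product would have order 6, so the group has exponent dividing a prime \<open>p \<in> {2, 3}\<close>
  (\<open>endo_triangle_free_exponent\<close>). Such a group is a vector space over the field with \<open>p\<close>
  elements, and a linear map can send a given nonzero vector to any vector
  (\<open>elementary_abelian_endomorphism\<close>). Thus all non-identity elements are adjacent, and since
  there is no triangle there are at most two of them. Connectedness provides at least one, so the
  order of the group is 2 or 3.

  Conversely, the same linear maps show that the groups of order 2 and 3 give the complete graph on
  one or two vertices, which is a tree.
\<close>

section \<open>Triangles and small complete graphs\<close>

lemma triangle_not_undirected_tree: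
  assumes "wf_digraph H"
    and "u \<rightarrow>\<^bsub>H\<^esub> v" "v \<rightarrow>\<^bsub>H\<^esub> w" "w \<rightarrow>\<^bsub>H\<^esub> u"
    and "distinct [u, v, w]"
  shows "\<not> undirected_tree H"
proof -
  interpret wf_digraph H by fact
  obtain d e f where
    "d \<in> arcs H" "tail H d = u" "head H d = v"
    "e \<in> arcs H" "tail H e = v" "head H e = w"
    "f \<in> arcs H" "tail H f = w" "head H f = u"
    using assms(2-4) by (auto elim!: reachableE)
  then have "cycle [d, e, f]"
    using assms(5) unfolding cycle_def
    by (intro exI[of _ u]) (auto simp: awalk_simps)
  then show ?thesis
    unfolding undirected_tree_def by force
qed

lemma complete_card_le_2_undirected_tree:
  assumes "wf_digraph H"
    and fin: "finite (verts H)" and "verts H \<noteq> {}" and card: "card (verts H) \<le> 2"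
    and complete: "\<And>u v. u \<in> verts H \<Longrightarrow> v \<in> verts H \<Longrightarrow> u \<noteq> v \<Longrightarrow> u \<rightarrow>\<^bsub>H\<^esub> v"
  shows "undirected_tree H"
proof -
  interpret wf_digraph H by fact
  have "u \<rightarrow>\<^sup>*\<^bsub>mk_symmetric H\<^esub> v" if "u \<in> verts H" "v \<in> verts H" for u v
    using that complete[of u v]
    by (intro reachable_mk_symmetricI) (cases "u = v"; auto intro: reachable_adjI)
  then have "Digraph_Component.connected H"
    using assms(3) unfolding connected_def strongly_connected_def by simp
  moreover have "length p < 3" if "cycle p" for p
  proof -
    from that obtain u where u: "awalk u p u" "distinct (tl (awalk_verts u p))"
      unfolding cycle_def by blast
    \<comment> \<open>A cycle visits as many different vertices as it has arcs.\<close>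
    have "length p = card (set (tl (awalk_verts u p)))"
      using distinct_card[OF u(2)] by (simp add: length_awalk_verts)
    also have "\<dots> \<le> card (verts H)"
    proof (rule card_mono[OF fin])
      have "set (tl (awalk_verts u p)) \<subseteq> set (awalk_verts u p)"
        by (cases "awalk_verts u p") auto
      also have "\<dots> \<subseteq> verts H"
        using u(1) by (simp only: awalk_conv)
      finally show "set (tl (awalk_verts u p)) \<subseteq> verts H" .
    qed
    finally show ?thesis using card by simp
  qed
  ultimately show ?thesis
    unfolding undirected_tree_def by (metis not_le)
qed

section \<open>Adjacency in the endomorphism graph\<close>

definition endo_adjacent :: "('a, 'b) monoid_scheme \<Rightarrow> 'a \<Rightarrow> 'a \<Rightarrow> bool" where
  "endo_adjacent G x y \<longleftrightarrow> x \<noteq> y \<and> (\<exists>f \<in> hom G G. f x = y \<or> f y = x)"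

definition endo_triangle_free :: "('a, 'b) monoid_scheme \<Rightarrow> bool" where
  "endo_triangle_free G \<longleftrightarrow>
     \<not> (\<exists>x \<in> carrier G - {\<one>\<^bsub>G\<^esub>}. \<exists>y \<in> carrier G - {\<one>\<^bsub>G\<^esub>}. \<exists>z \<in> carrier G - {\<one>\<^bsub>G\<^esub>}.
          endo_adjacent G x y \<and> endo_adjacent G y z \<and> endo_adjacent G z x)"

abbreviation punctured_endo_graph :: "('a, 'b) monoid_scheme \<Rightarrow> ('a, 'a \<times> 'a) pre_digraph" where
  "punctured_endo_graph G \<equiv>
     pre_digraph.del_vert (with_proj (endomorphism_graph G)) \<one>\<^bsub>G\<^esub>"

lemma endo_adjacentI: "f \<in> hom G G \<Longrightarrow> f x = y \<Longrightarrow> x \<noteq> y \<Longrightarrow> endo_adjacent G x y"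
  unfolding endo_adjacent_def by blast

lemma endo_adjacent_sym: "endo_adjacent G x y \<Longrightarrow> endo_adjacent G y x"
  unfolding endo_adjacent_def by blast

lemma endo_triangle_freeD:
  assumes "endo_triangle_free G" "x \<in> carrier G" "y \<in> carrier G" "z \<in> carrier G"
    and "x \<noteq> \<one>\<^bsub>G\<^esub>" "y \<noteq> \<one>\<^bsub>G\<^esub>" "z \<noteq> \<one>\<^bsub>G\<^esub>"
    and "endo_adjacent G x y" "endo_adjacent G y z" "endo_adjacent G z x"
  shows False
  using assms unfolding endo_triangle_free_def by blast

lemma wf_punctured_endo_graph: "wf_digraph (punctured_endo_graph G)"
  by unfold_locales (auto simp: pre_digraph.del_vert_simps endomorphism_graph_def)

lemma verts_punctured_endo_graph:
  "verts (punctured_endo_graph G) = carrier G - {\<one>\<^bsub>G\<^esub>}"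
  by (auto simp: pre_digraph.del_vert_simps endomorphism_graph_def)

lemma dominates_punctured_endo_graph:
  "x \<rightarrow>\<^bsub>punctured_endo_graph G\<^esub> y \<longleftrightarrow>
     x \<in> carrier G - {\<one>\<^bsub>G\<^esub>} \<and> y \<in> carrier G - {\<one>\<^bsub>G\<^esub>} \<and> endo_adjacent G x y"
  by (auto simp: arcs_ends_def arc_to_ends_def pre_digraph.del_vert_simps endomorphism_graph_def
      endo_adjacent_def image_iff)

lemma undirected_tree_imp_endo_triangle_free:
  assumes "undirected_tree (punctured_endo_graph G)"
  shows "endo_triangle_free G"
proof (rule ccontr)
  assume "\<not> endo_triangle_free G"
  then obtain x y z where
    "x \<in> carrier G - {\<one>\<^bsub>G\<^esub>}" "y \<in> carrier G - {\<one>\<^bsub>G\<^esub>}" "z \<in> carrier G - {\<one>\<^bsub>G\<^esub>}"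
    "endo_adjacent G x y" "endo_adjacent G y z" "endo_adjacent G z x"
    unfolding endo_triangle_free_def by blast
  moreover from this have "distinct [x, y, z]"
    by (auto simp: endo_adjacent_def)
  ultimately show False
    using triangle_not_undirected_tree[OF wf_punctured_endo_graph[of G], of x y z] assms
    by (simp add: dominates_punctured_endo_graph)
qed

section \<open>Triangle-free groups are abelian\<close>

context group
begin

lemma conjugation_hom: "g \<in> carrier G \<Longrightarrow> (\<lambda>x. g \<otimes> x \<otimes> inv g) \<in> hom G G"
  by (rule homI) (auto simp: m_assoc inv_solve_left)

lemma conjugation_mult:
  assumes "g \<in> carrier G" "h \<in> carrier G" "x \<in> carrier G"
  shows "(g \<otimes> h) \<otimes> x \<otimes> inv (g \<otimes> h) = g \<otimes> (h \<otimes> x \<otimes> inv h) \<otimes> inv g"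
  using assms by (simp add: m_assoc inv_mult_group)

lemma conjugation_eq_self_iff:
  assumes "g \<in> carrier G" "x \<in> carrier G"
  shows "g \<otimes> x \<otimes> inv g = x \<longleftrightarrow> g \<otimes> x = x \<otimes> g"
  using assms by (metis inv_solve_right m_closed)

lemma commute_inv:
  assumes "x \<in> carrier G" "y \<in> carrier G" "x \<otimes> y = y \<otimes> x"
  shows "x \<otimes> inv y = inv y \<otimes> x"
  using assms conjugation_eq_self_iff[of y x] by (simp add: inv_solve_left m_assoc)

lemma commute_mult_inv:
  assumes "x \<in> carrier G" "y \<in> carrier G" and comm: "x \<otimes> y = y \<otimes> x"
  shows "x \<otimes> (y \<otimes> inv x) = (y \<otimes> inv x) \<otimes> x"
proof -
  have "x \<otimes> (y \<otimes> inv x) = y \<otimes> x \<otimes> inv x"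
    using assms by (simp flip: m_assoc)
  then show ?thesis
    using assms by (simp add: m_assoc)
qed

lemma conjugation_inj:
  assumes "g \<in> carrier G" "x \<in> carrier G" "y \<in> carrier G"
  shows "g \<otimes> x \<otimes> inv g = g \<otimes> y \<otimes> inv g \<longleftrightarrow> x = y"
  using assms by simp

lemma endo_adjacent_conjugate:
  assumes "g \<in> carrier G" "x \<in> carrier G" "g \<otimes> x \<otimes> inv g \<noteq> x"
  shows "endo_adjacent G x (g \<otimes> x \<otimes> inv g)"
  using assms by (intro endo_adjacentI[OF conjugation_hom]) auto

text \<open>
  Two different nontrivial conjugates of \<open>a\<close> are conjugate to each other as well, so together
  with \<open>a\<close> they would be a triangle.
\<close>

lemma conjugates_unique:
  assumes free: "endo_triangle_free G"
    and [simp]: "a \<in> carrier G" "g \<in> carrier G" "h \<in> carrier G"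
    and g: "g \<otimes> a \<otimes> inv g \<noteq> a" and h: "h \<otimes> a \<otimes> inv h \<noteq> a"
  shows "g \<otimes> a \<otimes> inv g = h \<otimes> a \<otimes> inv h"
proof (rule ccontr)
  assume ne: "g \<otimes> a \<otimes> inv g \<noteq> h \<otimes> a \<otimes> inv h"
  have eq: "h \<otimes> a \<otimes> inv h = (h \<otimes> inv g) \<otimes> (g \<otimes> a \<otimes> inv g) \<otimes> inv (h \<otimes> inv g)"
    using conjugation_mult[of "h \<otimes> inv g" g a] by (simp add: m_assoc)
  have "endo_adjacent G (g \<otimes> a \<otimes> inv g) (h \<otimes> a \<otimes> inv h)"
    unfolding eq by (rule endo_adjacent_conjugate) (use ne eq in auto)
  moreover have "a \<noteq> \<one>" using g by auto
  moreover have "k \<otimes> a \<otimes> inv k \<noteq> \<one>" if "k \<in> carrier G" for k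
    using conjugation_inj[OF that, of a \<one>] \<open>a \<noteq> \<one>\<close> that by auto
  ultimately show False
    using endo_triangle_freeD[OF free, of a "g \<otimes> a \<otimes> inv g" "h \<otimes> a \<otimes> inv h"]
      endo_adjacent_conjugate[of g a] endo_adjacent_conjugate[of h a] g h
    by (auto intro: endo_adjacent_sym)
qed

text \<open>
  Conjugation by \<open>a \<otimes> b\<close> moves \<open>a\<close>, so by uniqueness it takes \<open>a\<close> to the same element as
  conjugation by \<open>b\<close>; in other words, conjugation by \<open>a\<close> fixes that element.
\<close>

lemma commute_with_conjugate:
  assumes free: "endo_triangle_free G"
    and [simp]: "a \<in> carrier G" "b \<in> carrier G" and ne: "b \<otimes> a \<noteq> a \<otimes> b"
  shows "a \<otimes> (b \<otimes> a \<otimes> inv b) = (b \<otimes> a \<otimes> inv b) \<otimes> a"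
proof -
  have "(a \<otimes> b) \<otimes> a \<noteq> a \<otimes> (a \<otimes> b)"
    using ne by (simp add: m_assoc)
  then have "(a \<otimes> b) \<otimes> a \<otimes> inv (a \<otimes> b) \<noteq> a"
    by (subst conjugation_eq_self_iff) auto
  moreover have "b \<otimes> a \<otimes> inv b \<noteq> a"
    using ne by (subst conjugation_eq_self_iff) auto
  ultimately have "(a \<otimes> b) \<otimes> a \<otimes> inv (a \<otimes> b) = b \<otimes> a \<otimes> inv b"
    using conjugates_unique[OF free, of a "a \<otimes> b" b] by simp
  then have "a \<otimes> (b \<otimes> a \<otimes> inv b) \<otimes> inv a = b \<otimes> a \<otimes> inv b"
    by (simp only: conjugation_mult assms)
  then show ?thesis
    by (subst (asm) conjugation_eq_self_iff) auto
qed

text \<open>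
  The centralizer of \<open>a\<close> has index at most 2, as \<open>a\<close> has at most one other conjugate.
\<close>

lemma noncommuting_product_commutes:
  assumes free: "endo_triangle_free G"
    and [simp]: "a \<in> carrier G" "g \<in> carrier G" "h \<in> carrier G"
    and g: "g \<otimes> a \<noteq> a \<otimes> g" and h: "h \<otimes> a \<noteq> a \<otimes> h"
  shows "(g \<otimes> h) \<otimes> a = a \<otimes> (g \<otimes> h)"
proof (rule ccontr)
  assume "(g \<otimes> h) \<otimes> a \<noteq> a \<otimes> (g \<otimes> h)"
  then have "(g \<otimes> h) \<otimes> a \<otimes> inv (g \<otimes> h) = g \<otimes> a \<otimes> inv g"
    using g conjugates_unique[OF free, of a "g \<otimes> h" g] by (simp add: conjugation_eq_self_iff)
  then have "h \<otimes> a \<otimes> inv h = a"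
    by (simp add: conjugation_mult conjugation_inj)
  then show False
    using h by (simp add: conjugation_eq_self_iff)
qed

text \<open>
  With \<open>a'\<close> and \<open>b'\<close> the other conjugates of two noncommuting elements \<open>a\<close> and \<open>b\<close>, the triangle
  consists of \<open>b\<close>, \<open>b'\<close> and the commutator \<open>z\<close>.
\<close>

lemma endo_triangle_free_imp_commute:
  assumes free: "endo_triangle_free G"
    and [simp]: "a \<in> carrier G" "b \<in> carrier G"
  shows "a \<otimes> b = b \<otimes> a"
proof (rule ccontr)
  assume "a \<otimes> b \<noteq> b \<otimes> a"
  then have ne: "b \<otimes> a \<noteq> a \<otimes> b" by simp
  define a' where "a' = b \<otimes> a \<otimes> inv b"
  define b' where "b' = a \<otimes> b \<otimes> inv a"
  define z where "z = a' \<otimes> inv a"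
  have [simp]: "a' \<in> carrier G" "b' \<in> carrier G" "z \<in> carrier G"
    by (simp_all add: a'_def b'_def z_def)
  have "a' \<noteq> a" "b' \<noteq> b"
    using ne by (auto simp: a'_def b'_def conjugation_eq_self_iff)
  have aa': "a \<otimes> a' = a' \<otimes> a"
    unfolding a'_def by (rule commute_with_conjugate[OF free]) (use ne in auto)
  have bb': "b \<otimes> b' = b' \<otimes> b"
    unfolding b'_def by (rule commute_with_conjugate[OF free]) (use ne in auto)
  have az: "a \<otimes> z = z \<otimes> a"
    unfolding z_def by (rule commute_mult_inv[OF _ _ aa']) auto
  \<comment> \<open>The inverse of \<open>z\<close> is the commutator with \<open>a\<close> and \<open>b\<close> exchanged, so \<open>z\<close> commutes with \<open>b\<close> too.\<close>
  have inv_z: "inv z = b' \<otimes> inv b"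
    by (simp add: z_def a'_def b'_def inv_mult_group m_assoc)
  have "b \<otimes> inv z = inv z \<otimes> b"
    unfolding inv_z by (rule commute_mult_inv[OF _ _ bb']) auto
  then have bz: "b \<otimes> z = z \<otimes> b"
    using commute_inv[of b "inv z"] by simp
  \<comment> \<open>Conjugation by \<open>b\<close> exchanges \<open>a\<close> and \<open>a'\<close>, hence inverts \<open>z\<close> as well as fixing it.\<close>
  have ba': "b \<otimes> a' \<otimes> inv b = a"
  proof -
    have "(b \<otimes> b) \<otimes> a \<otimes> inv (b \<otimes> b) = a"
      using noncommuting_product_commutes[OF free, of a b b] ne
      by (subst conjugation_eq_self_iff) auto
    then show ?thesis by (simp add: conjugation_mult a'_def)
  qed
  have "b \<otimes> z \<otimes> inv b = inv z"
  proof -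
    have "z \<otimes> a = a'"
      by (simp add: z_def m_assoc)
    then have "(b \<otimes> z \<otimes> inv b) \<otimes> (b \<otimes> a \<otimes> inv b) = b \<otimes> a' \<otimes> inv b"
      using hom_mult[OF conjugation_hom[of b], of z a] by simp
    then have "(b \<otimes> z \<otimes> inv b) \<otimes> a' = a"
      by (simp only: ba' flip: a'_def)
    then have "b \<otimes> z \<otimes> inv b = a \<otimes> inv a'"
      by (subst inv_solve_right) auto
    then show ?thesis
      by (simp add: z_def inv_mult_group)
  qed
  moreover have "b \<otimes> z \<otimes> inv b = z"
    using bz by (subst conjugation_eq_self_iff) auto
  ultimately have zz: "z \<otimes> z = \<one>"
    by (metis \<open>z \<in> carrier G\<close> r_inv)
  \<comment> \<open>The centralizer of \<open>a\<close> has index 2 and \<open>z\<close> is an involution, so this is an endomorphism.\<close>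
  define f where "f g = (if g \<otimes> a = a \<otimes> g then \<one> else z)" for g
  have "f \<in> hom G G"
  proof (rule homI)
    fix g h assume [simp]: "g \<in> carrier G" "h \<in> carrier G"
    have left: "(g \<otimes> h) \<otimes> a = a \<otimes> (g \<otimes> h) \<longleftrightarrow> h \<otimes> a = a \<otimes> h" if "g \<otimes> a = a \<otimes> g"
    proof -
      have "a \<otimes> (g \<otimes> h) = g \<otimes> (a \<otimes> h)"
        by (simp add: that flip: m_assoc)
      then show ?thesis by (simp add: m_assoc)
    qed
    have right: "(g \<otimes> h) \<otimes> a = a \<otimes> (g \<otimes> h) \<longleftrightarrow> g \<otimes> a = a \<otimes> g" if "h \<otimes> a = a \<otimes> h"
    proof -
      have "(g \<otimes> h) \<otimes> a = (g \<otimes> a) \<otimes> h"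
        by (simp add: that m_assoc)
      then show ?thesis by (simp flip: m_assoc)
    qed
    show "f (g \<otimes> h) = f g \<otimes> f h"
      using left right noncommuting_product_commutes[OF free, of a g h] zz
      by (auto simp: f_def)
  qed (simp add: f_def)
  have "b' \<otimes> a \<noteq> a \<otimes> b'"
  proof -
    have "b' \<otimes> a = a \<otimes> b"
      by (simp add: b'_def m_assoc)
    then show ?thesis using \<open>b' \<noteq> b\<close> by simp
  qed
  then have "f b = z" "f b' = z"
    using ne by (auto simp: f_def)
  moreover have "b \<noteq> z" "b' \<noteq> z"
    using az ne \<open>b' \<otimes> a \<noteq> a \<otimes> b'\<close> by auto
  moreover have "b \<noteq> \<one>" "b' \<noteq> \<one>"
    using ne \<open>b' \<otimes> a \<noteq> a \<otimes> b'\<close> by auto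
  moreover have "z \<noteq> \<one>"
    using \<open>a' \<noteq> a\<close> by (auto simp: z_def inv_solve_right')
  ultimately show False
    using endo_triangle_freeD[OF free, of b b' z] \<open>f \<in> hom G G\<close> \<open>b' \<noteq> b\<close>
      endo_adjacent_conjugate[of a b]
    by (auto simp: b'_def intro: endo_adjacentI endo_adjacent_sym)
qed

end

section \<open>Endomorphisms of elementary abelian groups\<close>

context comm_group
begin

lemma int_power_hom: "(\<lambda>x. x [^] (k::int)) \<in> hom G G"
  by (rule homI) (auto simp: int_pow_distrib)

lemma maximal_subgroup_avoiding:
  assumes "y \<in> carrier G" "y \<noteq> \<one>"
  obtains M where "subgroup M G" "y \<notin> M"
    "\<And>N. subgroup N G \<Longrightarrow> M \<subseteq> N \<Longrightarrow> y \<notin> N \<Longrightarrow> N = M"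
proof -
  define \<A> where "\<A> = {H. subgroup H G \<and> y \<notin> H}"
  have "\<exists>M\<in>\<A>. \<forall>X\<in>\<A>. M \<subseteq> X \<longrightarrow> X = M"
  proof (rule subset_Zorn_nonempty)
    show "\<A> \<noteq> {}"
      using triv_subgroup assms by (auto simp: \<A>_def)
    fix \<C> assume C: "\<C> \<noteq> {}" "subset.chain \<A> \<C>"
    then have sub: "subgroup H G" "y \<notin> H" if "H \<in> \<C>" for H
      using that by (auto simp: \<A>_def subset.chain_def)
    have "subgroup (\<Union>\<C>) G"
    proof (rule subgroupI)
      show "\<Union>\<C> \<subseteq> carrier G" using sub(1) subgroup.subset by blast
      show "\<Union>\<C> \<noteq> {}" using C(1) sub(1) subgroup.one_closed by blast
      show "inv a \<in> \<Union>\<C>" if "a \<in> \<Union>\<C>" for a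
        using that subgroup.m_inv_closed[OF sub(1)] by auto
      show "a \<otimes> b \<in> \<Union>\<C>" if ab: "a \<in> \<Union>\<C>" "b \<in> \<Union>\<C>" for a b
      proof -
        obtain H K where HK: "H \<in> \<C>" "K \<in> \<C>" "a \<in> H" "b \<in> K" using ab by blast
        then have "H \<subseteq> K \<or> K \<subseteq> H" using C(2) by (auto simp: subset.chain_def)
        then obtain L where "L \<in> \<C>" "a \<in> L" "b \<in> L"
          using HK by blast
        then show ?thesis
          using subgroup.m_closed[OF sub(1)] by auto
      qed
    qed
    then show "\<Union>\<C> \<in> \<A>" using sub by (auto simp: \<A>_def)
  qed
  then show ?thesis using that by (auto simp: \<A>_def)
qed

text \<open>
  By \<open>dec\<close>, the subgroup \<open>M\<close> and the powers of \<open>y\<close> generate the group; \<open>unique\<close> is exactly what makes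
  sending \<open>m \<otimes> y [^] k\<close>, with \<open>m\<close> in \<open>M\<close>, to \<open>u [^] k\<close> well defined.
\<close>

lemma hom_of_complement:
  assumes M: "subgroup M G" and [simp]: "y \<in> carrier G" "u \<in> carrier G"
    and dec: "\<And>g. g \<in> carrier G \<Longrightarrow> \<exists>k::int. g \<otimes> y [^] (- k) \<in> M"
    and unique: "\<And>k::int. y [^] k \<in> M \<Longrightarrow> u [^] k = \<one>"
  obtains f where "f \<in> hom G G" "f y = u"
proof -
  define c where "c g = (SOME k::int. g \<otimes> y [^] (- k) \<in> M)" for g
  have c: "g \<otimes> y [^] (- c g) \<in> M" if "g \<in> carrier G" for g
    unfolding c_def by (rule someI_ex[OF dec[OF that]])
  have eq: "u [^] k = u [^] l"
    if g: "g \<in> carrier G" and "g \<otimes> y [^] (- k) \<in> M" "g \<otimes> y [^] (- l) \<in> M" for g and k l :: int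
  proof -
    have "inv (g \<otimes> y [^] (- k)) \<otimes> (g \<otimes> y [^] (- l)) \<in> M"
      using that M by (simp add: subgroup.m_closed subgroup.m_inv_closed)
    also have "inv (g \<otimes> y [^] (- k)) \<otimes> (g \<otimes> y [^] (- l)) = y [^] (k - l)"
      using g by (simp add: inv_mult_group m_assoc int_pow_neg int_pow_diff inv_solve_left')
    finally have "u [^] (k - l) = \<one>" by (rule unique)
    then show ?thesis by (simp add: int_pow_diff inv_solve_right')
  qed
  have "(\<lambda>g. u [^] c g) \<in> hom G G"
  proof (rule homI)
    fix g h assume [simp]: "g \<in> carrier G" "h \<in> carrier G"
    have "(g \<otimes> y [^] (- c g)) \<otimes> (h \<otimes> y [^] (- c h)) \<in> M"
      using c M by (simp add: subgroup.m_closed)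
    also have "(g \<otimes> y [^] (- c g)) \<otimes> (h \<otimes> y [^] (- c h)) = (g \<otimes> h) \<otimes> (y [^] (- c g) \<otimes> y [^] (- c h))"
      by (simp add: m_ac)
    also have "y [^] (- c g) \<otimes> y [^] (- c h) = y [^] (- (c g + c h))"
      by (simp flip: int_pow_mult)
    finally have "u [^] c (g \<otimes> h) = u [^] (c g + c h)"
      using c by (intro eq[of "g \<otimes> h"]) auto
    then show "u [^] c (g \<otimes> h) = u [^] c g \<otimes> u [^] c h"
      by (simp add: int_pow_mult)
  qed simp
  moreover have "u [^] c y = u [^] (1::int)"
    using c subgroup.one_closed[OF M] by (intro eq[of y]) (auto simp: int_pow_neg)
  ultimately show ?thesis using that by simp
qed

text \<open>
  A subgroup \<open>M\<close> that is maximal among those avoiding \<open>y\<close> is a complement of the subgroup generated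
  by \<open>y\<close>: for \<open>g\<close> outside \<open>M\<close>, the subgroup generated by \<open>M\<close> and \<open>g\<close> contains \<open>y\<close>, and solving for
  \<open>g\<close> is possible since exponents prime to \<open>p\<close> are invertible. This replaces the choice of a basis
  containing \<open>y\<close>.
\<close>

lemma elementary_abelian_endomorphism:
  fixes p :: nat
  assumes p: "prime p" and exp: "\<And>x. x \<in> carrier G \<Longrightarrow> x [^] p = \<one>"
    and [simp]: "y \<in> carrier G" "u \<in> carrier G" and "y \<noteq> \<one>"
  obtains f where "f \<in> hom G G" "f y = u"
proof -
  obtain M where M: "subgroup M G" "y \<notin> M"
    and max: "\<And>N. subgroup N G \<Longrightarrow> M \<subseteq> N \<Longrightarrow> y \<notin> N \<Longrightarrow> N = M"
    using maximal_subgroup_avoiding assms(3,5) by metis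
  have powM: "m [^] k \<in> M" if "m \<in> M" for m and k :: int
    using that M(1) by (rule subgroup_int_pow_closed[rotated])
  have periodic: "x [^] (k + int p * l) = x [^] k" if [simp]: "x \<in> carrier G" for x and k l :: int
  proof -
    have "x [^] (int p * l) = (x [^] p) [^] l"
      by (simp add: int_pow_pow int_pow_int flip: int_pow_int)
    then show ?thesis by (simp add: int_pow_mult exp)
  qed
  have recover: "\<exists>j. x [^] (k * j) = x"
    if [simp]: "x \<in> carrier G" and k: "\<not> int p dvd k" for x and k :: int
  proof -
    have "coprime (int p) k"
      using prime_imp_coprime[of "int p" k] p k by simp
    then obtain l j where "l * int p + j * k = 1"
      using bezout_int[of "int p" k] by auto
    then have "k * j = 1 + int p * (- l)"
      by (simp add: algebra_simps)
    then have "x [^] (k * j) = x"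
      using periodic[of x 1 "- l"] by simp
    then show ?thesis ..
  qed
  show ?thesis
  proof (rule hom_of_complement[OF M(1), of y u])
    fix k :: int assume yk: "y [^] k \<in> M"
    have "int p dvd k"
    proof (rule ccontr)
      assume "\<not> int p dvd k"
      then obtain j where "y [^] (k * j) = y"
        using recover[of y k] by auto
      then have "(y [^] k) [^] j = y"
        by (simp add: int_pow_pow)
      then show False
        using powM[OF yk, of j] M(2) by simp
    qed
    then show "u [^] k = \<one>"
      using periodic[of u 0] by (auto elim!: dvdE)
  next
    fix g assume [simp]: "g \<in> carrier G"
    show "\<exists>k::int. g \<otimes> y [^] (- k) \<in> M"
    proof (cases "g \<in> M")
      case True
      then show ?thesis
        using subgroup.subset[OF M(1)] by (intro exI[of _ 0]) auto
    next
      case False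
      define N where "N = M <#> generate G {g}"
      have "subgroup N G"
        unfolding N_def by (intro mult_subgroups M(1) generate_is_subgroup) simp
      moreover have "M \<subseteq> N"
        using subgroup.subset[OF M(1)] generate.one[of G "{g}"]
        by (force simp: N_def set_mult_def)
      moreover have "g \<in> N"
        using subgroup.one_closed[OF M(1)] generate.incl[of g "{g}" G]
        by (force simp: N_def set_mult_def)
      ultimately have "y \<in> N"
        using max False by metis
      then obtain m k where m: "m \<in> M" and y: "y = m \<otimes> g [^] (k::int)"
        by (auto simp: N_def set_mult_def generate_pow)
      have [simp]: "m \<in> carrier G"
        using m subgroup.subset[OF M(1)] by blast
      have "\<not> int p dvd k"
      proof
        assume "int p dvd k"
        then have "g [^] k = \<one>"
          using periodic[of g 0] by (auto elim!: dvdE)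
        then show False
          using y m M(2) by simp
      qed
      then obtain j where "g [^] (k * j) = g"
        using recover[of g k] by auto
      then have "y [^] j = m [^] j \<otimes> g"
        by (simp add: y int_pow_distrib int_pow_pow)
      then have "g \<otimes> y [^] (- j) = inv (m [^] j)"
        by (simp add: int_pow_neg inv_mult_group flip: m_assoc)
      moreover have "inv (m [^] j) \<in> M"
        using powM[OF m] subgroup.m_inv_closed[OF M(1)] by simp
      ultimately show ?thesis by metis
    qed
  qed (use that in auto)
qed

lemma elementary_abelian_endo_adjacent:
  fixes p :: nat
  assumes "prime p" "\<And>x. x \<in> carrier G \<Longrightarrow> x [^] p = \<one>"
    and "x \<in> carrier G - {\<one>}" "y \<in> carrier G" "x \<noteq> y"
  shows "endo_adjacent G x y"
proof -
  obtain f where "f \<in> hom G G" "f x = y"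
    using elementary_abelian_endomorphism[of p x y, OF assms(1,2)] assms(3,4) by blast
  then show ?thesis
    using assms(5) by (rule endo_adjacentI)
qed

section \<open>Abelian groups without triangles\<close>

text \<open>
  The triangle is formed by \<open>x\<close>, its inverse and its square; the square is also the power of the
  inverse with exponent \<open>- 2\<close>. These elements coincide or are trivial only when the order of \<open>x\<close>
  divides 2 or 3.
\<close>

lemma endo_triangle_free_ord:
  assumes free: "endo_triangle_free G" and [simp]: "x \<in> carrier G"
  shows "ord x dvd 2 \<or> ord x dvd 3"
proof (rule ccontr)
  assume "\<not> ?thesis"
  then have n2: "\<not> int (ord x) dvd 2" and n3: "\<not> int (ord x) dvd 3"
    using int_dvd_int_iff[of "ord x" 2] int_dvd_int_iff[of "ord x" 3] by auto
  then have n1: "\<not> int (ord x) dvd 1"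
    by (meson dvd_trans one_dvd)
  define y z where "y = x [^] (-1::int)" and "z = x [^] (2::int)"
  have [simp]: "y \<in> carrier G" "z \<in> carrier G"
    by (simp_all add: y_def z_def)
  have "endo_adjacent G x y"
    by (rule endo_adjacentI[OF int_power_hom[of "-1"]])
      (use n2 in \<open>auto simp: y_def int_pow_eq[of x 1, simplified]\<close>)
  moreover have "endo_adjacent G y z"
    by (rule endo_adjacentI[OF int_power_hom[of "-2"]])
      (use n3 in \<open>auto simp: y_def z_def int_pow_pow int_pow_eq\<close>)
  moreover have "endo_adjacent G x z"
    by (rule endo_adjacentI[OF int_power_hom[of 2]])
      (use n1 in \<open>auto simp: z_def int_pow_eq[of x 1, simplified]\<close>)
  moreover have "x \<noteq> \<one>" "y \<noteq> \<one>" "z \<noteq> \<one>"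
    using n1 n2 by (auto simp: y_def z_def int_pow_eq_id)
  ultimately show False
    using endo_triangle_freeD[OF free, of x y z] by (auto intro: endo_adjacent_sym)
qed

text \<open>
  If \<open>a\<close> had order 3 and \<open>b\<close> order 2, then \<open>a \<otimes> b\<close> would have order 6.
\<close>

lemma endo_triangle_free_exponent:
  assumes free: "endo_triangle_free G"
  obtains p :: nat where "p = 2 \<or> p = 3" "\<And>x. x \<in> carrier G \<Longrightarrow> x [^] p = \<one>"
proof -
  have pow: "x [^] (2::nat) = \<one> \<or> x [^] (3::nat) = \<one>" if "x \<in> carrier G" for x
    using endo_triangle_free_ord[OF free that] that by (simp add: pow_eq_id)
  have "(\<forall>x\<in>carrier G. x [^] (2::nat) = \<one>) \<or> (\<forall>x\<in>carrier G. x [^] (3::nat) = \<one>)"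
  proof (rule ccontr)
    assume "\<not> ?thesis"
    then obtain a b where [simp]: "a \<in> carrier G" "b \<in> carrier G"
      and ab: "a [^] (2::nat) \<noteq> \<one>" "b [^] (3::nat) \<noteq> \<one>"
      by blast
    then have "a [^] (3::nat) = \<one>" "b [^] (2::nat) = \<one>"
      using pow[of a] pow[of b] by auto
    then have "(a \<otimes> b) [^] (2::nat) = a [^] (2::nat)" "(a \<otimes> b) [^] (3::nat) = b [^] (3::nat)"
      using pow_mult_distrib[of a b] by (simp_all add: m_comm)
    then show False
      using pow[of "a \<otimes> b"] ab by simp
  qed
  then show ?thesis using that by blast
qed

text \<open>
  Any two non-identity elements are adjacent, so three of them would form a triangle.
\<close>

lemma endo_triangle_free_order:
  assumes free: "endo_triangle_free G"
  shows "finite (carrier G)" "order G \<le> 3"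
proof -
  obtain p :: nat where p: "p = 2 \<or> p = 3" and exp: "\<And>x. x \<in> carrier G \<Longrightarrow> x [^] p = \<one>"
    using endo_triangle_free_exponent[OF free] by blast
  have "prime p" using p by auto
  note adjacent = elementary_abelian_endo_adjacent[OF this exp]
  have "finite (carrier G - {\<one>}) \<and> card (carrier G - {\<one>}) \<le> 2"
  proof (rule ccontr)
    assume big: "\<not> ?thesis"
    have "\<exists>T. T \<subseteq> carrier G - {\<one>} \<and> card T = 3"
    proof (cases "finite (carrier G - {\<one>})")
      case True
      then show ?thesis
        using big obtain_subset_with_card_n[of 3 "carrier G - {\<one>}"] by auto
    next
      case False
      then show ?thesis
        using infinite_arbitrarily_large[of "carrier G - {\<one>}" 3] by blast
    qed
    then obtain x y z where "{x, y, z} \<subseteq> carrier G - {\<one>}" "x \<noteq> y" "y \<noteq> z" "z \<noteq> x"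
      unfolding card_3_iff by blast
    then show False
      using endo_triangle_freeD[OF free, of x y z] adjacent[of x y] adjacent[of y z] adjacent[of z x]
      by simp
  qed
  then show "finite (carrier G)" "order G \<le> 3"
    by (auto simp: order_def card_Diff_singleton)
qed

end

section \<open>Groups of prime order\<close>

text \<open>
  Every \<open>a \<noteq> \<one>\<close> generates the group, by Lagrange, and \<open>k \<mapsto> a [^] k\<close> is the isomorphism.
\<close>

lemma (in group) prime_order_iso_integer_mod_group:
  assumes p: "prime (order G)"
  shows "G \<cong> integer_mod_group (order G)"
proof -
  define n where "n = order G"
  have n: "n > 1" using prime_gt_1_nat[OF p] by (simp add: n_def)
  have fin: "finite (carrier G)"
    using n unfolding n_def by (intro order_gt_0_iff_finite[THEN iffD1]) simp
  obtain a where a[simp]: "a \<in> carrier G" and "a \<noteq> \<one>"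
  proof -
    have "\<not> carrier G \<subseteq> {\<one>}"
      using n card_mono[of "{\<one>}" "carrier G"] by (auto simp: n_def order_def)
    then show ?thesis using that by blast
  qed
  have "ord a = n"
    using ord_dvd_group_order[OF a] p \<open>a \<noteq> \<one>\<close> ord_eq_1[OF a]
    by (auto simp: n_def prime_nat_iff)
  define \<phi> where "\<phi> k = a [^] k" for k :: int
  have \<phi>_eq: "\<phi> k = \<phi> l \<longleftrightarrow> int n dvd l - k" for k l
    by (simp add: \<phi>_def int_pow_eq \<open>ord a = n\<close>)
  have "\<phi> \<in> hom (integer_mod_group n) G"
  proof (rule homI)
    fix k l
    have "\<phi> ((k + l) mod int n) = \<phi> (k + l)"
      by (simp add: \<phi>_eq minus_mod_eq_mult_div)
    then show "\<phi> (k \<otimes>\<^bsub>integer_mod_group n\<^esub> l) = \<phi> k \<otimes> \<phi> l"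
      by (simp add: \<phi>_def int_pow_mult)
  qed (simp add: \<phi>_def)
  moreover have "bij_betw \<phi> (carrier (integer_mod_group n)) (carrier G)"
  proof -
    have inj: "inj_on \<phi> {0..<int n}"
    proof (rule inj_onI)
      fix k l assume "k \<in> {0..<int n}" "l \<in> {0..<int n}" "\<phi> k = \<phi> l"
      then show "k = l"
        using mod_eq_dvd_iff[of l "int n" k] by (simp add: \<phi>_eq)
    qed
    have "\<phi> ` {0..<int n} = carrier G"
    proof (rule card_subset_eq[OF fin])
      show "\<phi> ` {0..<int n} \<subseteq> carrier G"
        by (simp add: \<phi>_def image_subset_iff)
      show "card (\<phi> ` {0..<int n}) = card (carrier G)"
        unfolding card_image[OF inj] by (simp add: n_def order_def)
    qed
    then show ?thesis
      using inj n by (simp add: bij_betw_def carrier_integer_mod_group)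
  qed
  ultimately have "integer_mod_group n \<cong> G"
    by (intro is_isoI[of \<phi>]) (simp add: iso_def)
  then show ?thesis
    unfolding n_def by (rule group.iso_sym[OF group_integer_mod_group])
qed

lemma (in group) undirected_tree_of_order_2_or_3:
  assumes order: "order G = 2 \<or> order G = 3" and "comm_group G"
  shows "undirected_tree (punctured_endo_graph G)"
proof -
  interpret comm_group G by fact
  have fin: "finite (carrier G)"
    using order by (intro order_gt_0_iff_finite[THEN iffD1]) auto
  have "prime (order G)"
    using order by auto
  have card: "card (carrier G - {\<one>}) = order G - 1"
    using fin by (simp add: order_def)
  show ?thesis
  proof (rule complete_card_le_2_undirected_tree[OF wf_punctured_endo_graph])
    show "verts (punctured_endo_graph G) \<noteq> {}"
    proof
      assume "verts (punctured_endo_graph G) = {}"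
      then have "card (carrier G - {\<one>}) = 0"
        by (simp only: verts_punctured_endo_graph card.empty)
      then show False
        using card order by auto
    qed
  next
    fix u v
    assume "u \<in> verts (punctured_endo_graph G)" "v \<in> verts (punctured_endo_graph G)" "u \<noteq> v"
    then show "u \<rightarrow>\<^bsub>punctured_endo_graph G\<^esub> v"
      using elementary_abelian_endo_adjacent[OF \<open>prime (order G)\<close> pow_order_eq_1]
      by (auto simp: verts_punctured_endo_graph dominates_punctured_endo_graph)
  qed (use fin card order in \<open>auto simp: verts_punctured_endo_graph\<close>)
qed

theorem theorem7p3:
  fixes G :: "('a, 'b) monoid_scheme"
  assumes "group G"
  shows "undirected_tree
           (pre_digraph.del_vert (with_proj (endomorphism_graph G)) \<one>\<^bsub>G\<^esub>)
         \<longleftrightarrow> G \<cong> integer_mod_group 2 \<or> G \<cong> integer_mod_group 3"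
proof
  interpret group G by fact
  assume tree: "undirected_tree (punctured_endo_graph G)"
  then have free: "endo_triangle_free G"
    by (rule undirected_tree_imp_endo_triangle_free)
  interpret comm_group G
    using endo_triangle_free_imp_commute[OF free] by (intro group_comm_groupI)
  have "carrier G - {\<one>\<^bsub>G\<^esub>} \<noteq> {}"
    using tree verts_punctured_endo_graph[of G]
    by (auto simp: undirected_tree_def connected_def strongly_connected_def)
  then have "0 < card (carrier G - {\<one>\<^bsub>G\<^esub>})"
    unfolding card_gt_0_iff using endo_triangle_free_order(1)[OF free] by blast
  then have "order G = 2 \<or> order G = 3"
    using endo_triangle_free_order[OF free] by (auto simp: order_def)
  then show "G \<cong> integer_mod_group 2 \<or> G \<cong> integer_mod_group 3"
    using prime_order_iso_integer_mod_group by auto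
next
  interpret group G by fact
  assume iso: "G \<cong> integer_mod_group 2 \<or> G \<cong> integer_mod_group 3"
  then have "order G = 2 \<or> order G = 3"
    by (auto dest!: iso_same_card simp: order_def carrier_integer_mod_group)
  moreover have "comm_group G"
    using iso comm_group.iso_imp_comm_group[OF abelian_integer_mod_group]
      iso_sym is_monoid by blast
  ultimately show "undirected_tree (punctured_endo_graph G)"
    by (rule undirected_tree_of_order_2_or_3)
qed

end
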